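(* For every $\zeta\in\mathbb C$, $$\det(\zeta\mathbf 1-\Omega)=(\det\alpha)^{-1}\det C(\zeta,0)=(\det\alpha)^{-1}\det(\zeta^2\alpha+2\theta\mathrm i\zeta-\eta),\qquad \det(\zeta\mathbf 1-B)=\zeta^N(\det\alpha)^{-1}\det(\zeta\alpha-R),$$ and $$\sigma(\Omega)=\sigma(C(\cdot,0))\subseteq\mathbb R,\qquad \sigma(\Omega)=-\sigma(\Omega),\qquad \sigma(B)\setminus\{0\}=\sigma(\alpha^{-1}R)\setminus\{0\}.$$ In particular, if $b_{\min}$ and $\omega_{\max}$ denote the smallest nonzero eigenvalue of $B$ and the largest eigenvalue of $\Omega$, respectively, then $$b_{\min}=\min[\sigma(\alpha^{-1}R)\setminus\{0\}],\qquad \omega_{\max}=\|\Omega\|=\max\sigma(C(\cdot,0)).$$ Moreover, if $\eta>0$ then $$\sigma(\Omega^\flat)=-\sigma(\Omega)^{-1}=\sigma(\Omega^{-1}),\qquad \sigma(B^\flat)\setminus\{0\}=\sigma(\eta^{-1}R)\setminus\{0\}.$$ In particular, if $\eta>0$ and $b_{\min}^\flat$ and $\omega_{\max}^\flat$ denote the smallest nonzero eigenvalue of $B^\flat$ and the largest eigenvalue of $\Omega^\flat$, respectively, then $$b_{\min}^\flat=\min[\sigma(\eta^{-1}R)\setminus\{0\}],\qquad \omega_{\max}^\flat=\|\Omega^\flat\|=\|\Omega^{-1}\|=\omega_{\min}^{-1},$$ where $\omega_{\min}=\min|\sigma(\Omega)|$ is the smallest positive eigenvalue of $\Omega$.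
   Context: Setting. $N\ge 1$; $\alpha,\eta,\theta,R$ are real $N\times N$ matrices with $\alpha^{\mathrm T}=\alpha>0$, $\eta^{\mathrm T}=\eta\ge0$, $\theta^{\mathrm T}=-\theta$, $R^{\mathrm T}=R\ge0$, and $\operatorname{rank}R>0$. $\sqrt{\cdot}$ denotes the positive semidefinite square root, $\|\cdot\|$ the operator norm. On $\mathbb C^{2N}=\mathbb C^N\oplus\mathbb C^N$ set $$\Omega=\begin{bmatrix}-2\mathrm i\sqrt\alpha^{-1}\theta\sqrt\alpha^{-1} & -\mathrm i\Phi^{\mathrm T}\\ \mathrm i\Phi&0\end{bmatrix},\quad \Phi=\sqrt\eta\sqrt\alpha^{-1},\quad B=\begin{bmatrix}\sqrt\alpha^{-1}R\sqrt\alpha^{-1}&0\\0&0\end{bmatrix}.$$ The quadratic matrix pencil is $C(\zeta,\beta)=\zeta^2\alpha+(2\theta+\beta R)\mathrm i\zeta-\eta$, with spectrum $\sigma(C(\cdot,\beta))=\{\zeta\in\mathbb C:\det C(\zeta,\beta)=0\}$. For a set $S\subset\mathbb C\setminus\{0\}$, $-S^{-1}=\{-\zeta^{-1}:\zeta\in S\}$; $|S|=\{|\zeta|:\zeta\in S\}$. When $\eta>0$, $\Omega^\flat$ and $B^\flat$ are defined as $\Omega$ and $B$ but with $\alpha$ and $\eta$ interchanged (and $\Omega$ is then invertible). *)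

theory Defs
  imports "HOL-Analysis.Analysis"
begin

definition pos_semidef :: "real^'n^'n \<Rightarrow> bool" where
  "pos_semidef A \<longleftrightarrow> transpose A = A \<and> (\<forall>x. 0 \<le> x \<bullet> (A *v x))"

definition pos_def :: "real^'n^'n \<Rightarrow> bool" where
  "pos_def A \<longleftrightarrow> transpose A = A \<and> (\<forall>x. x \<noteq> 0 \<longrightarrow> 0 < x \<bullet> (A *v x))"

text \<open>Meaningful only for positive semidefinite \<open>A\<close>, for which the root exists and is unique.\<close>
definition psd_sqrt :: "real^'n^'n \<Rightarrow> real^'n^'n" where
  "psd_sqrt A = (THE S. pos_semidef S \<and> S ** S = A)"

abbreviation cmat :: "real^'n^'m \<Rightarrow> complex^'n^'m" where
  "cmat \<equiv> map_matrix complex_of_real"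

definition scale_mat :: "complex \<Rightarrow> complex^'n^'m \<Rightarrow> complex^'n^'m"  (infixr \<open>*\<^sub>m\<close> 75) where
  "c *\<^sub>m A = map_matrix ((*) c) A"

text \<open>
  The index type \<^typ>\<open>'n + 'n\<close> makes \<^typ>\<open>complex^('n + 'n)\<close>, with its Euclidean norm, the
  orthogonal direct sum of two copies of \<^typ>\<open>complex^'n\<close>.
\<close>
definition block_mat ::
  "complex^'n^'n \<Rightarrow> complex^'n^'n \<Rightarrow> complex^'n^'n \<Rightarrow> complex^'n^'n \<Rightarrow> complex^('n + 'n)^('n + 'n)" where
  "block_mat A B C D = (\<chi> i j.
     case i of
       Inl a \<Rightarrow> (case j of Inl b \<Rightarrow> A $ a $ b | Inr b \<Rightarrow> B $ a $ b)
     | Inr a \<Rightarrow> (case j of Inl b \<Rightarrow> C $ a $ b | Inr b \<Rightarrow> D $ a $ b))"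

definition Phi_mat :: "real^'n^'n \<Rightarrow> real^'n^'n \<Rightarrow> real^'n^'n" where
  "Phi_mat \<alpha> \<eta> = psd_sqrt \<eta> ** matrix_inv (psd_sqrt \<alpha>)"

definition Omega_mat ::
  "real^'n^'n \<Rightarrow> real^'n^'n \<Rightarrow> real^'n^'n \<Rightarrow> complex^('n + 'n)^('n + 'n)" where
  "Omega_mat \<alpha> \<eta> \<theta> = block_mat
     ((- 2 * \<i>) *\<^sub>m cmat (matrix_inv (psd_sqrt \<alpha>) ** \<theta> ** matrix_inv (psd_sqrt \<alpha>)))
     ((- \<i>) *\<^sub>m cmat (transpose (Phi_mat \<alpha> \<eta>)))
     (\<i> *\<^sub>m cmat (Phi_mat \<alpha> \<eta>))
     0"

definition B_mat :: "real^'n^'n \<Rightarrow> real^'n^'n \<Rightarrow> complex^('n + 'n)^('n + 'n)" where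
  "B_mat \<alpha> R = block_mat (cmat (matrix_inv (psd_sqrt \<alpha>) ** R ** matrix_inv (psd_sqrt \<alpha>))) 0 0 0"

text \<open>
  The dual matrices arise by interchanging \<open>\<alpha>\<close> and \<open>\<eta>\<close>; \<^term>\<open>B_mat \<alpha> R\<close> does not involve \<open>\<eta>\<close>.
\<close>
definition Omega_flat ::
  "real^'n^'n \<Rightarrow> real^'n^'n \<Rightarrow> real^'n^'n \<Rightarrow> complex^('n + 'n)^('n + 'n)" where
  "Omega_flat \<alpha> \<eta> \<theta> = Omega_mat \<eta> \<alpha> \<theta>"

definition B_flat :: "real^'n^'n \<Rightarrow> real^'n^'n \<Rightarrow> complex^('n + 'n)^('n + 'n)" where
  "B_flat \<eta> R = B_mat \<eta> R"

definition pencil ::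
  "real^'n^'n \<Rightarrow> real^'n^'n \<Rightarrow> real^'n^'n \<Rightarrow> real^'n^'n \<Rightarrow> complex \<Rightarrow> real \<Rightarrow> complex^'n^'n" where
  "pencil \<alpha> \<eta> \<theta> R \<zeta> \<beta> =
     \<zeta>\<^sup>2 *\<^sub>m cmat \<alpha> + (\<i> * \<zeta>) *\<^sub>m cmat (2 *\<^sub>R \<theta> + \<beta> *\<^sub>R R) - cmat \<eta>"

definition pencil_spectrum :: "(complex \<Rightarrow> complex^'n^'n) \<Rightarrow> complex set" where
  "pencil_spectrum P = {\<zeta>. det (P \<zeta>) = 0}"

definition mat_spectrum :: "complex^'n^'n \<Rightarrow> complex set" where
  "mat_spectrum A = {\<zeta>. \<exists>v. v \<noteq> 0 \<and> A *v v = \<zeta> *s v}"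

definition op_norm :: "complex^'n^'m \<Rightarrow> real" where
  "op_norm A = onorm (\<lambda>v. A *v v)"

text \<open>
  Extremal elements are only asserted of sets of complex numbers that consist of real numbers; the
  predicates include this and the attainment of the extremum.
\<close>
definition is_smallest :: "complex set \<Rightarrow> real \<Rightarrow> bool" where
  "is_smallest S x \<longleftrightarrow> S \<subseteq> \<real> \<and> complex_of_real x \<in> S \<and> (\<forall>z\<in>S. x \<le> Re z)"

definition is_largest :: "complex set \<Rightarrow> real \<Rightarrow> bool" where
  "is_largest S x \<longleftrightarrow> S \<subseteq> \<real> \<and> complex_of_real x \<in> S \<and> (\<forall>z\<in>S. Re z \<le> x)"

end

theory Submission
  imports Defs
begin

text \<open>
  A Schur complement reduces the determinant of \<open>\<zeta> - \<Omega>\<close> to that of the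
  pencil. Since \<open>\<Omega>\<close> is Hermitian, its spectrum is real, and since the pencil at \<open>-\<zeta>\<close> is the transpose
  of the pencil at \<open>\<zeta>\<close>, the spectrum is symmetric; hence the operator norm, which up to sign is an
  eigenvalue of any Hermitian matrix, is the largest eigenvalue. Interchanging \<open>\<alpha>\<close> and \<open>\<eta>\<close> turns the
  pencil at \<open>\<zeta>\<close> into \<open>-\<zeta>\<^sup>2\<close> times the pencil at \<open>-1 / \<zeta>\<close>, which gives the duality.
\<close>

section \<open>Determinants of block matrices\<close>

text \<open>The square roots inside \<open>Omega_mat\<close> and \<open>B_mat\<close> are definite
  descriptions, so existence and uniqueness of a positive semidefinite root have to be established
  before these matrices can be handled. Uniqueness, the eigenbasis behind existence, and the claims
  on the operator norm share one source: a self-adjoint operator on a real Euclidean space has an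
  eigenvalue whose modulus bounds its norm. This covers Hermitian matrices too, since the inner
  product of \<open>complex^'n\<close> is the real part of the Hermitian one.

  The factor 1 / det \<alpha> comes from a congruence. With P the inverse root of \<alpha>, P
  \<alpha> P is the identity, and the Schur complement, cleared of its denominator \<zeta>, equals P
  C(\<zeta>, 0) P, while (det P)^2 = 1 / det \<alpha>. Clearing the denominator is possible because
  the lower right block of \<zeta> - \<Omega> is the scalar \<zeta>; only \<zeta> = 0 needs a
  separate argument.\<close>

lemma block_mat_Inl_Inl [simp]: "block_mat A B C D $ Inl i $ Inl j = A $ i $ j"
  and block_mat_Inl_Inr [simp]: "block_mat A B C D $ Inl i $ Inr j = B $ i $ j"
  and block_mat_Inr_Inl [simp]: "block_mat A B C D $ Inr i $ Inl j = C $ i $ j"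
  and block_mat_Inr_Inr [simp]: "block_mat A B C D $ Inr i $ Inr j = D $ i $ j"
  by (simp_all add: block_mat_def)

lemma prod_UNIV_sum_type:
  fixes f :: "'a::finite + 'b::finite \<Rightarrow> 'c::comm_monoid_mult"
  shows "prod f UNIV = (\<Prod>i\<in>UNIV. f (Inl i)) * (\<Prod>i\<in>UNIV. f (Inr i))"
  using prod.Plus[of "UNIV :: 'a set" "UNIV :: 'b set" f] by (simp add: o_def)

lemma sum_UNIV_sum_type:
  fixes f :: "'a::finite + 'b::finite \<Rightarrow> 'c::comm_monoid_add"
  shows "sum f UNIV = (\<Sum>i\<in>UNIV. f (Inl i)) + (\<Sum>i\<in>UNIV. f (Inr i))"
  using sum.Plus[of "UNIV :: 'a set" "UNIV :: 'b set" f] by (simp add: o_def)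

lemma block_mat_eqI:
  fixes M N :: "complex^('n::finite + 'n)^('n + 'n)"
  assumes "\<And>i j. M $ Inl i $ Inl j = N $ Inl i $ Inl j" "\<And>i j. M $ Inl i $ Inr j = N $ Inl i $ Inr j"
    "\<And>i j. M $ Inr i $ Inl j = N $ Inr i $ Inl j" "\<And>i j. M $ Inr i $ Inr j = N $ Inr i $ Inr j"
  shows "M = N"
  unfolding vec_eq_iff by (metis assms sum.exhaust)

lemma block_mat_mult:
  "block_mat A B C D ** block_mat A' B' C' D' =
   block_mat (A ** A' + B ** C') (A ** B' + B ** D') (C ** A' + D ** C') (C ** B' + D ** D')"
  by (rule block_mat_eqI) (simp_all add: matrix_matrix_mult_def sum_UNIV_sum_type)

lemma block_mat_diff:
  "block_mat A B C D - block_mat A' B' C' D' = block_mat (A - A') (B - B') (C - C') (D - D')"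
  by (rule block_mat_eqI) simp_all

lemma mat_eq_block_mat: "mat z = block_mat (mat z) 0 0 (mat z)"
  by (rule block_mat_eqI) (simp_all add: mat_def)

text \<open>In the Leibniz sum a permutation that moves some \<open>Inr b\<close> meets a zero entry
  of the identity block. The remaining permutations act on the range of \<open>Inl\<close> only, and
  transport along \<open>Inl\<close> preserves their sign.\<close>

lemma det_block_mat_one:
  fixes A :: "complex^'a^'a"
  shows "det (block_mat A 0 0 (mat 1)) = det A"
proof -
  let ?M = "block_mat A 0 0 (mat 1)"
  let ?L = "range Inl :: ('a + 'a) set"
  let ?h = "map_permutation UNIV (Inl :: 'a \<Rightarrow> 'a + 'a)"
  have bL: "bij_betw Inl UNIV ?L" by (simp add: bij_betw_def)
  have "det ?M = (\<Sum>p | p permutes ?L. of_int (sign p) * (\<Prod>i\<in>UNIV. ?M $ i $ p i))"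
    unfolding det_def
  proof (rule sum.mono_neutral_right)
    show "\<forall>p\<in>{p. p permutes UNIV} - {p. p permutes ?L}. of_int (sign p) * (\<Prod>i\<in>UNIV. ?M $ i $ p i) = 0"
    proof
      fix p assume p: "p \<in> {p. p permutes (UNIV::('a+'a) set)} - {p. p permutes ?L}"
      have "\<exists>b. p (Inr b) \<noteq> Inr b"
      proof (rule ccontr)
        assume "\<not> ?thesis"
        then have "p x = x" if "x \<notin> ?L" for x using that by (cases x) blast+
        then have "p permutes ?L"
          using p permutes_superset[of p UNIV ?L] by blast
        with p show False by simp
      qed
      then obtain b where b: "p (Inr b) \<noteq> Inr b" by blast
      have "?M $ Inr b $ p (Inr b) = 0"
        using b by (cases "p (Inr b)") (auto simp: mat_def)
      then show "of_int (sign p) * (\<Prod>i\<in>UNIV. ?M $ i $ p i) = 0"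
        using prod_zero[of UNIV "\<lambda>i. ?M $ i $ p i"] by auto
    qed
    show "{p. p permutes ?L} \<subseteq> {p. p permutes UNIV}"
      using permutes_subset by blast
  qed (simp add: finite_permutations)
  also have "\<dots> = (\<Sum>q | q permutes UNIV. of_int (sign (?h q)) * (\<Prod>i\<in>UNIV. ?M $ i $ ?h q i))"
  proof (rule sum.reindex_bij_betw[symmetric], rule bij_betw_byWitness[where f' = "map_permutation ?L projl"])
    show "\<forall>q\<in>{q. q permutes UNIV}. map_permutation ?L projl (?h q) = q"
      using map_permutation_compose_inv[OF bL] by auto
    have bL': "bij_betw projl ?L UNIV" by (rule bij_betw_byWitness[where f' = Inl]) auto
    have pr: "Inl (projl x) = x" if "x \<in> ?L" for x :: "'a + 'a" using that by auto
    show "\<forall>p\<in>{p. p permutes ?L}. ?h (map_permutation ?L projl p) = p"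
      using map_permutation_compose_inv[OF bL', of _ Inl] pr by blast
    show "?h ` {q. q permutes UNIV} \<subseteq> {p. p permutes ?L}"
      using map_permutation_permutes[OF bL] by auto
    show "map_permutation ?L projl ` {p. p permutes ?L} \<subseteq> {q. q permutes UNIV}"
      using map_permutation_permutes[OF bL'] by auto
  qed
  also have "\<dots> = (\<Sum>q | q permutes UNIV. of_int (sign q) * (\<Prod>i\<in>UNIV. A $ i $ q i))"
  proof (rule sum.cong[OF refl])
    fix q :: "'a \<Rightarrow> 'a" assume "q \<in> {q. q permutes UNIV}"
    then have q: "q permutes UNIV" by simp
    have "?h q (Inl i) = Inl (q i)" for i
      by (simp add: map_permutation_apply)
    moreover have "?h q (Inr i) = Inr i" for i
      by (rule permutes_not_in[OF map_permutation_permutes[OF bL q]]) auto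
    moreover have "sign (?h q) = sign q"
      by (rule sign_map_permutation) (use q in auto)
    ultimately show "of_int (sign (?h q)) * (\<Prod>i\<in>UNIV. ?M $ i $ ?h q i)
        = of_int (sign q) * (\<Prod>i\<in>UNIV. A $ i $ q i)"
      by (simp add: prod_UNIV_sum_type mat_def)
  qed
  also have "\<dots> = det A" by (simp add: det_def)
  finally show ?thesis .
qed

lemma mat_mult_eq_scale: "mat c ** A = c *\<^sub>m A" "A ** mat c = c *\<^sub>m A"
  by (simp_all add: matrix_matrix_mult_def mat_def scale_mat_def vec_eq_iff if_distrib if_distribR
      mult.commute cong: if_cong)

lemma mat_two_mult: "mat 2 ** X = X + X" for X :: "complex^'n^'n"
  by (simp add: mat_mult_eq_scale scale_mat_def vec_eq_iff)

text \<open>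
  The determinant is multiplicative in the additive variable \<open>X\<close>, and conjugation by a diagonal matrix
  shows that it takes the same value at \<open>X\<close> and \<open>X + X\<close>; so it is a nonzero idempotent.
\<close>
lemma det_block_mat_lower_one:
  fixes X :: "complex^'n^'n"
  shows "det (block_mat (mat 1) 0 X (mat 1)) = 1"
proof -
  define f where "f X = det (block_mat (mat 1) 0 X (mat 1))" for X :: "complex^'n^'n"
  have add: "f (X + Y) = f X * f Y" for X Y
    unfolding f_def det_mul[symmetric] by (simp add: block_mat_mult add.commute)
  have "f (X + X) = f X"
  proof -
    let ?d = "\<lambda>t. block_mat (mat 1) 0 0 (mat t :: complex^'n^'n)"
    have "?d 2 ** block_mat (mat 1) 0 X (mat 1) = block_mat (mat 1) 0 (X + X) (mat 1) ** ?d 2"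
      by (simp add: block_mat_mult mat_two_mult)
    then have "det (?d 2) * f X = f (X + X) * det (?d 2)"
      unfolding f_def det_mul[symmetric] by simp
    moreover have "det (?d 2) \<noteq> 0"
      by (subst det_diagonal) (auto simp: prod_UNIV_sum_type mat_def block_mat_def split: sum.split)
    ultimately show ?thesis by simp
  qed
  moreover have "f X * f (- X) = 1"
    using add[of X "-X"] det_block_mat_one[of "mat 1 :: complex^'n^'n"] by (simp add: f_def)
  ultimately show ?thesis using add[of X X] unfolding f_def by auto
qed

lemma transpose_block_mat:
  "transpose (block_mat A B C D) = block_mat (transpose A) (transpose C) (transpose B) (transpose D)"
  by (rule block_mat_eqI) (simp_all add: transpose_def)

lemma transpose_zero: "transpose 0 = (0 :: 'a::zero^'n^'m)"
  by (simp add: transpose_def vec_eq_iff)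

lemma scale_mat_zero: "0 *\<^sub>m A = 0"
  by (simp add: scale_mat_def vec_eq_iff)

lemma scale_mat_one: "1 *\<^sub>m A = A"
  by (simp add: scale_mat_def vec_eq_iff)

lemma det_block_mat_upper_one:
  fixes X :: "complex^'n^'n"
  shows "det (block_mat (mat 1) X 0 (mat 1)) = 1"
  using det_block_mat_lower_one[of "transpose X"]
    det_transpose[of "block_mat (mat 1) X 0 (mat 1)"]
  by (simp add: transpose_block_mat transpose_zero)

lemma matrix_neg_mult: "(- A) ** B = - (A ** B)" "A ** (- B) = - (A ** B)"
  for A :: "'a::comm_ring_1^'n^'m" and B :: "'a^'p^'n"
  by (simp_all add: matrix_matrix_mult_def vec_eq_iff sum_negf)

text \<open>A quarter turn is a product of three shears. It exchanges block columns with determinant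
  1, so no sign depending on the dimension has to be tracked.\<close>

lemma det_block_mat_rotation:
  "det (block_mat 0 (- mat 1) (mat 1) (0 :: complex^'n^'n)) = 1" (is "det ?W = 1")
proof -
  let ?U = "block_mat (mat 1) (- mat 1) 0 (mat 1 :: complex^'n^'n)"
  have "?W = ?U ** block_mat (mat 1) 0 (mat 1) (mat 1) ** ?U"
    by (simp add: block_mat_mult matrix_neg_mult)
  then show ?thesis
    by (simp only: det_mul det_block_mat_upper_one det_block_mat_lower_one mult_1)
qed

lemma det_block_mat_one_left:
  fixes D :: "complex^'n^'n"
  shows "det (block_mat (mat 1) 0 0 D) = det D"
proof -
  let ?W = "block_mat 0 (- mat 1) (mat 1) (0 :: complex^'n^'n)"
  have "block_mat (mat 1) 0 0 D ** ?W = ?W ** block_mat D 0 0 (mat 1)"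
    by (simp add: block_mat_mult)
  then show ?thesis
    by (metis det_mul det_block_mat_rotation det_block_mat_one mult_1 mult_1_right)
qed

text \<open>With the shear placed between the two diagonal factors, the factorization inverts
  neither \<open>A\<close> nor \<open>D\<close>.\<close>

lemma det_block_mat_upper:
  fixes A B D :: "complex^'n^'n"
  shows "det (block_mat A B 0 D) = det A * det D"
proof -
  have "block_mat A B 0 D
      = block_mat (mat 1) 0 0 D ** block_mat (mat 1) B 0 (mat 1) ** block_mat A 0 0 (mat 1)"
    by (simp add: block_mat_mult)
  then show ?thesis
    by (simp add: det_mul det_block_mat_one_left det_block_mat_upper_one det_block_mat_one)
qed

lemma det_block_mat_lower:
  fixes A C D :: "complex^'n^'n"
  shows "det (block_mat A 0 C D) = det A * det D"
  using det_block_mat_upper[of "transpose A" "transpose C" "transpose D"]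
    det_transpose[of "block_mat A 0 C D"]
  by (simp add: transpose_block_mat transpose_zero)

lemma det_mat: "det (mat c :: 'a::comm_ring_1^'n^'n) = c ^ CARD('n)"
  by (subst det_diagonal) (simp_all add: mat_def)

text \<open>This is the Schur complement formula for a scalar lower right block, multiplied through
  by \<open>z\<close> so that it makes sense for every \<open>z\<close>.\<close>

lemma det_block_mat_scalar:
  fixes A B C :: "complex^'n^'n"
  shows "det (block_mat A B C (mat z)) = det (z *\<^sub>m A - B ** C)"
proof (cases "z = 0")
  case True
  \<comment> \<open>The Schur complement is unavailable; swapping the block columns makes the matrix triangular.\<close>
  have "block_mat A B C 0 ** block_mat 0 (- mat 1) (mat 1) 0 = block_mat B (- A) 0 (- C)"
    by (simp add: block_mat_mult matrix_neg_mult)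
  then have "det (block_mat A B C 0) = det B * det (- C)"
    by (metis det_mul det_block_mat_rotation det_block_mat_upper mult_1_right)
  also have "\<dots> = det (- (B ** C))" by (simp flip: det_mul add: matrix_neg_mult)
  finally show ?thesis using True by (simp add: scale_mat_zero)
next
  case False
  \<comment> \<open>Since \<open>mat z\<close> commutes with \<open>C\<close>, the right factor
    clears the lower left block. Both sides then carry the determinant of \<open>mat z\<close>,
    which cancels for nonzero \<open>z\<close>.\<close>
  have "block_mat A B C (mat z) ** block_mat (mat z) 0 (- C) (mat 1)
      = block_mat (z *\<^sub>m A - B ** C) B 0 (mat z)"
    by (simp add: block_mat_mult matrix_neg_mult mat_mult_eq_scale scale_mat_one)
  then have "det (block_mat A B C (mat z)) * det (mat z :: complex^'n^'n)
      = det (z *\<^sub>m A - B ** C) * det (mat z :: complex^'n^'n)"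
    using det_mul[of "block_mat A B C (mat z)" "block_mat (mat z) 0 (- C) (mat 1)"]
    by (auto simp: det_block_mat_upper det_block_mat_lower)
  then show ?thesis using False by (simp add: det_mat)
qed

section \<open>Positive semidefinite square roots\<close>

text \<open>
  A unit vector \<open>v\<close> of \<open>S\<close> maximizing the norm of \<open>T v\<close> satisfies \<open>T (T v) = m\<^sup>2 v\<close> by the equality case of
  Cauchy--Schwarz, so that \<open>(T - m) (T + m) v = 0\<close>.
\<close>
lemma selfadjoint_norm_eigenvector:
  fixes T :: "'a::euclidean_space \<Rightarrow> 'a"
  assumes T: "linear T" and adj: "\<And>x y. T x \<bullet> y = x \<bullet> T y"
    and S: "subspace S" and inv: "\<And>x. x \<in> S \<Longrightarrow> T x \<in> S" and ne: "\<exists>x\<in>S. x \<noteq> 0"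
  obtains m v where "0 \<le> m" "\<And>x. x \<in> S \<Longrightarrow> norm (T x) \<le> m * norm x"
    "v \<in> S" "v \<noteq> 0" "T v = m *\<^sub>R v \<or> T v = (- m) *\<^sub>R v"
proof -
  interpret T: linear T by fact
  let ?K = "S \<inter> sphere 0 1"
  have "compact ?K"
    using S by (metis Int_commute closed_subspace compact_Int_closed compact_sphere)
  moreover obtain x0 where "x0 \<in> S" "x0 \<noteq> 0" using ne by blast
  then have "(1 / norm x0) *\<^sub>R x0 \<in> ?K" using S by (simp add: subspace_scale)
  then have "?K \<noteq> {}" by blast
  moreover have "continuous_on ?K (\<lambda>x. norm (T x))"
    by (intro continuous_intros linear_continuous_on linear_conv_bounded_linear[THEN iffD1] T)
  ultimately obtain v where v: "v \<in> ?K" and max: "\<And>x. x \<in> ?K \<Longrightarrow> norm (T x) \<le> norm (T v)"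
    using continuous_attains_sup by metis
  define m where "m = norm (T v)"
  have vS: "v \<in> S" and nv: "norm v = 1" using v by auto
  have le: "norm (T x) \<le> m * norm x" if "x \<in> S" for x
  proof (cases "x = 0")
    case False
    then have "(1 / norm x) *\<^sub>R x \<in> ?K" using S that by (simp add: subspace_scale)
    then have "norm (T ((1 / norm x) *\<^sub>R x)) \<le> m" using max m_def by blast
    then show ?thesis using False by (simp add: T.scale divide_simps mult.commute)
  qed (simp add: T.zero)
  have "norm (T (T v)) \<le> m * m" using le[OF inv[OF vS]] by (simp add: m_def)
  moreover have "T (T v) \<bullet> v = m * m"
    by (simp add: adj[of "T v"] m_def power2_norm_eq_inner[symmetric] power2_eq_square)
  moreover have "v \<bullet> v = 1" using nv by (simp add: dot_square_norm)
  moreover have "(norm (T (T v)))\<^sup>2 \<le> (m * m)\<^sup>2"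
    using calculation(1) by (rule power_mono) simp
  ultimately have "(norm (T (T v) - (m * m) *\<^sub>R v))\<^sup>2 \<le> 0"
    unfolding power2_norm_eq_inner
    by (simp add: inner_diff_left inner_diff_right inner_commute power2_eq_square)
  then have TT: "T (T v) = (m * m) *\<^sub>R v" by simp
  show thesis
  proof (cases "T v = (- m) *\<^sub>R v")
    case True
    show ?thesis using that[of m v] le vS nv True m_def by fastforce
  next
    case False
    let ?w = "T v + m *\<^sub>R v"
    have "?w \<noteq> 0" using False by (simp add: eq_neg_iff_add_eq_0)
    moreover have "T ?w = m *\<^sub>R ?w"
      by (simp add: T.add T.scale TT scaleR_right_distrib add.commute)
    moreover have "?w \<in> S" using S vS inv by (simp add: subspace_add subspace_scale)
    ultimately show ?thesis using that[of m ?w] le m_def by auto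
  qed
qed

text \<open>An orthonormal set of eigenvectors of maximal cardinality exists because the dimension
  bounds its size. Its orthogonal complement is invariant by self-adjointness, so if it were nonzero
  it would contain a further eigenvector; this is why the preceding lemma is stated for invariant
  subspaces.\<close>

lemma selfadjoint_eigenbasis:
  fixes T :: "'a::euclidean_space \<Rightarrow> 'a"
  assumes T: "linear T" and adj: "\<And>x y. T x \<bullet> y = x \<bullet> T y"
  obtains B l where "finite B" "pairwise orthogonal B" "\<And>b. b \<in> B \<Longrightarrow> norm b = 1" "span B = UNIV"
    "\<And>b. b \<in> B \<Longrightarrow> T b = l b *\<^sub>R b"
proof -
  interpret T: linear T by fact
  define P where "P B \<longleftrightarrow> pairwise orthogonal B \<and> (\<forall>b\<in>B. norm b = 1 \<and> (\<exists>c. T b = c *\<^sub>R b))" for B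
  have fin: "finite B \<and> card B \<le> DIM('a)" if "P B" for B
    using that pairwise_orthogonal_independent[of B] independent_bound[of B] unfolding P_def by fastforce
  have "P {}" by (simp add: P_def)
  then obtain B where B: "P B" and max: "\<And>B'. P B' \<Longrightarrow> card B' \<le> card B"
    using ex_has_greatest_nat[of P "{}" card "Suc DIM('a)"] fin less_Suc_eq_le by metis
  have "span B = UNIV"
  proof (rule ccontr)
    assume "span B \<noteq> UNIV"
    then obtain d where d: "d \<noteq> 0" "\<And>y. y \<in> span B \<Longrightarrow> orthogonal d y"
      using orthogonal_to_subspace_exists[of B] dim_eq_full[of B]
      by (metis dim_subset_UNIV order_le_less)
    define S where "S = {x. \<forall>b\<in>B. x \<bullet> b = 0}"
    have "subspace S" by (auto simp: S_def subspace_def inner_left_distrib)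
    moreover have "T x \<in> S" if "x \<in> S" for x
      using that B unfolding S_def P_def by (fastforce simp: adj)
    moreover have "\<exists>x\<in>S. x \<noteq> 0" using d by (intro bexI[of _ d]) (auto simp: S_def orthogonal_def span_base)
    ultimately obtain m v where v: "v \<in> S" "v \<noteq> 0" "T v = m *\<^sub>R v \<or> T v = (- m) *\<^sub>R v"
      using selfadjoint_norm_eigenvector[OF T adj] by metis
    define w where "w = (1 / norm v) *\<^sub>R v"
    have w: "norm w = 1" "\<exists>c. T w = c *\<^sub>R w" "w \<in> S"
      using v unfolding w_def S_def by (auto simp: T.scale intro: exI[of _ m] exI[of _ "-m"])
    then have "w \<notin> B" unfolding S_def by auto
    moreover have "P (insert w B)"
      using B w unfolding P_def S_def pairwise_insert by (auto simp: orthogonal_def inner_commute)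
    ultimately show False using max[of "insert w B"] fin[OF B] by simp
  qed
  then show thesis
    using that[of B "\<lambda>b. SOME c. T b = c *\<^sub>R b"] B fin[OF B] unfolding P_def
    by (metis (mono_tags, lifting) someI_ex)
qed

lemma transpose_eq_selfadjoint:
  fixes A :: "real^'n^'n"
  assumes "transpose A = A"
  shows "(A *v x) \<bullet> y = x \<bullet> (A *v y)"
  by (metis assms dot_lmul_matrix vector_transpose_matrix)

lemma selfadjoint_transpose_eq:
  fixes A :: "real^'n^'n"
  assumes "\<And>x y. (A *v x) \<bullet> y = x \<bullet> (A *v y)"
  shows "transpose A = A"
  by (metis assms adjoint_matrix adjoint_unique matrix_of_matrix_vector_mul)

text \<open>The root acts on an orthonormal eigenbasis by the square roots of the eigenvalues, which
  are nonnegative as values of the quadratic form at unit vectors. That it squares to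
  \<open>A\<close> needs checking on the basis only.\<close>

lemma psd_root_exists:
  fixes A :: "real^'n^'n"
  assumes "pos_semidef A"
  shows "\<exists>S. pos_semidef S \<and> S ** S = A"
proof -
  have tr: "transpose A = A" and pos: "\<And>x. 0 \<le> x \<bullet> (A *v x)"
    using assms by (auto simp: pos_semidef_def)
  obtain B l where B: "finite B" "pairwise orthogonal B" "\<And>b. b \<in> B \<Longrightarrow> norm b = 1" "span B = UNIV"
    "\<And>b. b \<in> B \<Longrightarrow> A *v b = l b *\<^sub>R b"
    by (rule selfadjoint_eigenbasis[of "(*v) A"]) (auto simp: transpose_eq_selfadjoint[OF tr])
  have lpos: "0 \<le> l b" if "b \<in> B" for b
    using pos[of b] B(3,5)[OF that] by (simp add: dot_square_norm)
  define s where "s x = (\<Sum>b\<in>B. (sqrt (l b) * (b \<bullet> x)) *\<^sub>R b)" for x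
  have lin: "linear s"
    unfolding s_def
    by (rule linearI) (simp_all add: inner_right_distrib algebra_simps sum.distrib scaleR_sum_right)
  have sb: "s b = sqrt (l b) *\<^sub>R b" if "b \<in> B" for b
  proof -
    have "s b = (\<Sum>c\<in>B. if c = b then sqrt (l b) *\<^sub>R b else 0)"
      unfolding s_def
    proof (rule sum.cong[OF refl])
      fix c assume "c \<in> B"
      then show "(sqrt (l c) * (c \<bullet> b)) *\<^sub>R c = (if c = b then sqrt (l b) *\<^sub>R b else 0)"
        using that B(2,3) by (auto simp: pairwise_def orthogonal_def dot_square_norm)
    qed
    then show ?thesis using that B(1) by simp
  qed
  define S where "S = matrix s"
  have S: "S *v x = s x" for x by (simp add: S_def lin matrix_works)
  have adj: "s x \<bullet> y = x \<bullet> s y" for x y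
    by (simp add: s_def inner_sum_left inner_sum_right inner_commute mult_ac)
  have "transpose S = S"
    by (rule selfadjoint_transpose_eq) (simp add: S adj)
  moreover have "0 \<le> x \<bullet> (S *v x)" for x
  proof -
    have "x \<bullet> (S *v x) = (\<Sum>b\<in>B. sqrt (l b) * (b \<bullet> x)\<^sup>2)"
      by (simp add: S s_def inner_sum_right inner_commute power2_eq_square mult.assoc)
    then show ?thesis using lpos by (simp add: sum_nonneg)
  qed
  moreover have "(S ** S) *v x = A *v x" for x
  proof -
    have "x \<in> span B" using B(4) by simp
    then show ?thesis
    proof (rule linear_eq_on[rotated 2])
      fix b assume "b \<in> B"
      then show "S ** S *v b = A *v b"
        by (simp add: matrix_vector_mul_assoc[symmetric] S sb linear_scale[OF lin] B(5) lpos)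
    qed auto
  qed
  ultimately show ?thesis
    by (meson pos_semidef_def matrix_eq)
qed

text \<open>
  For an eigenvector \<open>v\<close> of \<open>D = S - S'\<close> with eigenvalue \<open>c\<close>, the identity \<open>S D + D S' = 0\<close> yields
  \<open>c (v \<bullet> S v + v \<bullet> S' v) = 0\<close>, where both summands are nonnegative and differ by \<open>c (v \<bullet> v)\<close>.
\<close>
lemma psd_root_unique:
  fixes S S' :: "real^'n^'n"
  assumes "pos_semidef S" "pos_semidef S'" "S ** S = S' ** S'"
  shows "S = S'"
proof -
  let ?D = "S - S'"
  have trD: "transpose ?D = ?D"
    using assms by (simp add: pos_semidef_def transpose_def vec_eq_iff)
  obtain m v where m: "0 \<le> m" "\<And>x. norm (?D *v x) \<le> m * norm x"
    and v: "v \<noteq> 0" "?D *v v = m *\<^sub>R v \<or> ?D *v v = (- m) *\<^sub>R v"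
    using selfadjoint_norm_eigenvector[of "(*v) ?D" UNIV, OF _ transpose_eq_selfadjoint[OF trD]]
    by (auto intro: exI[of _ 1])
  then obtain c where c: "?D *v v = c *\<^sub>R v" "m = \<bar>c\<bar>" by fastforce
  have "S *v (?D *v v) + ?D *v (S' *v v) = (S ** S) *v v - (S' ** S') *v v"
    by (simp add: matrix_vector_mul_assoc[symmetric] matrix_vector_mult_diff_distrib matrix_vector_mult_diff_rdistrib)
  then have "v \<bullet> (S *v (?D *v v)) + v \<bullet> (?D *v (S' *v v)) = 0"
    using assms(3) by (simp flip: inner_right_distrib)
  moreover have "v \<bullet> (?D *v (S' *v v)) = c * (v \<bullet> (S' *v v))"
    by (metis c(1) inner_scaleR_left transpose_eq_selfadjoint[OF trD])
  ultimately have "c * (v \<bullet> (S *v v) + v \<bullet> (S' *v v)) = 0"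
    by (simp add: c(1) matrix_vector_mult_scaleR distrib_left del: matrix_vector_mult_diff_rdistrib)
  moreover have "c * (v \<bullet> v) = v \<bullet> (S *v v) - v \<bullet> (S' *v v)"
    by (metis c(1) inner_diff_right inner_scaleR_right matrix_vector_mult_diff_rdistrib)
  moreover have "0 \<le> v \<bullet> (S *v v)" "0 \<le> v \<bullet> (S' *v v)"
    using assms by (auto simp: pos_semidef_def)
  ultimately have "c = 0" using v(1) by (smt (verit) inner_eq_zero_iff mult_eq_0_iff)
  \<comment> \<open>The modulus of \<open>c\<close> is the bound \<open>m\<close> for
    \<open>?D\<close> on all vectors, so the vanishing of this single eigenvalue annihilates the
    whole matrix.\<close>
  then have "?D *v x = 0 *v x" for x using m(2)[of x] c(2) by simp
  then show ?thesis by (metis matrix_eq eq_iff_diff_eq_0)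
qed

lemma psd_sqrt:
  assumes "pos_semidef A"
  shows "pos_semidef (psd_sqrt A)" "psd_sqrt A ** psd_sqrt A = A"
proof -
  have "\<exists>!S. pos_semidef S \<and> S ** S = A"
    using psd_root_exists[OF assms] psd_root_unique by metis
  then have "pos_semidef (psd_sqrt A) \<and> psd_sqrt A ** psd_sqrt A = A"
    unfolding psd_sqrt_def by (rule theI')
  then show "pos_semidef (psd_sqrt A)" "psd_sqrt A ** psd_sqrt A = A" by auto
qed

section \<open>Spectra of self-adjoint matrices\<close>

text \<open>The inner product here is real-valued. Replacing \<open>y\<close> by
  \<open>\<i> *s y\<close> recovers the imaginary part, so for a complex matrix this is the usual
  Hermitian condition, in the form to which \<open>selfadjoint_norm_eigenvector\<close> applies
  directly.\<close>

definition self_adjoint :: "complex^'n^'n \<Rightarrow> bool" where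
  "self_adjoint A \<longleftrightarrow> (\<forall>x y. (A *v x) \<bullet> y = x \<bullet> (A *v y))"

lemma inner_complex_Re: "x \<bullet> y = Re (x * cnj y)" for x y :: complex
  by (simp add: inner_complex_def)

lemma self_adjointI:
  assumes "\<And>i j. A $ i $ j = cnj (A $ j $ i)"
  shows "self_adjoint A"
  unfolding self_adjoint_def
proof (intro allI)
  fix x y
  have "(A *v x) \<bullet> y = Re (\<Sum>i\<in>UNIV. \<Sum>j\<in>UNIV. A $ i $ j * x $ j * cnj (y $ i))"
    by (simp add: inner_vec_def inner_complex_Re matrix_vector_mult_def sum_distrib_right)
  also have "\<dots> = Re (\<Sum>j\<in>UNIV. \<Sum>i\<in>UNIV. A $ i $ j * x $ j * cnj (y $ i))"
    by (subst sum.swap) simp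
  also have "\<dots> = Re (\<Sum>j\<in>UNIV. \<Sum>i\<in>UNIV. x $ j * cnj (A $ j $ i * y $ i))"
    by (subst assms) (simp add: mult_ac)
  also have "\<dots> = x \<bullet> (A *v y)"
    by (simp add: inner_vec_def inner_complex_Re matrix_vector_mult_def sum_distrib_left)
  finally show "(A *v x) \<bullet> y = x \<bullet> (A *v y)" .
qed

lemma inner_smult_smult: "(w *s v) \<bullet> (z *s v) = Re (w * cnj z) * (v \<bullet> v)" for v :: "complex^'n"
  by (simp add: inner_vec_def inner_complex_def sum_distrib_left algebra_simps)

lemma norm_smult: "norm (z *s v) = cmod z * norm v" for v :: "complex^'n"
proof -
  have "(norm (z *s v))\<^sup>2 = (cmod z * norm v)\<^sup>2"
    by (simp add: power_mult_distrib power2_norm_eq_inner inner_smult_smult inner_complex_Re)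
  then show ?thesis by simp
qed

lemma of_real_smult: "complex_of_real r *s v = r *\<^sub>R v" for v :: "complex^'n"
  by (simp add: vec_eq_iff scaleR_conv_of_real[where 'a = complex])

lemma matrix_vector_mult_smult: "A *v (c *s v) = c *s (A *v v)" for A :: "complex^'n^'m"
  by (simp add: matrix_vector_mult_def vec_eq_iff sum_distrib_left mult_ac)

text \<open>The real inner product sees the imaginary part of an eigenvalue once an eigenvector
  \<open>v\<close> is tested against \<open>\<i> *s v\<close>: self-adjointness then equates Im z
  with -Im z, up to the factor \<open>v \<bullet> v\<close>.\<close>

lemma self_adjoint_spectrum_real:
  assumes "self_adjoint A"
  shows "mat_spectrum A \<subseteq> \<real>"
proof
  fix z assume "z \<in> mat_spectrum A"
  then obtain v where v: "v \<noteq> 0" "A *v v = z *s v" unfolding mat_spectrum_def by blast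
  have "(A *v v) \<bullet> (\<i> *s v) = v \<bullet> (A *v (\<i> *s v))"
    using assms by (simp add: self_adjoint_def)
  then have "(z *s v) \<bullet> (\<i> *s v) = (1 *s v) \<bullet> ((\<i> * z) *s v)"
    by (simp add: v matrix_vector_mult_smult)
  then show "z \<in> \<real>"
    unfolding inner_smult_smult using v(1) by (simp add: complex_is_Real_iff)
qed

text \<open>Choosing one eigenvector per eigenvalue gives pairwise orthogonal nonzero vectors, of
  which there are finitely many. Orthogonality in the real inner product suffices because the
  eigenvalues are real.\<close>

lemma self_adjoint_spectrum_finite:
  assumes "self_adjoint A"
  shows "finite (mat_spectrum A)"
proof -
  define f where "f z = (SOME v. v \<noteq> 0 \<and> A *v v = z *s v)" for z
  have f: "f z \<noteq> 0" "A *v f z = z *s f z" if "z \<in> mat_spectrum A" for z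
    using that someI_ex[of "\<lambda>v. v \<noteq> 0 \<and> A *v v = z *s v"] unfolding f_def mat_spectrum_def by auto
  have "f z \<bullet> f w = 0" if zw: "z \<in> mat_spectrum A" "w \<in> mat_spectrum A" "z \<noteq> w" for z w
  proof -
    have "z \<in> \<real>" "w \<in> \<real>" using zw self_adjoint_spectrum_real[OF assms] by auto
    then obtain a b where ab: "z = complex_of_real a" "w = complex_of_real b"
      by (elim Reals_cases) blast
    have "(A *v f z) \<bullet> f w = f z \<bullet> (A *v f w)" using assms by (simp add: self_adjoint_def)
    then have "a * (f z \<bullet> f w) = b * (f z \<bullet> f w)"
      using f zw by (simp add: ab of_real_smult)
    then show ?thesis using zw ab by simp
  qed
  then have orth: "f z \<bullet> f w = 0" if "z \<in> mat_spectrum A" "w \<in> mat_spectrum A" "z \<noteq> w" for z w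
    using that by blast
  then have "pairwise orthogonal (f ` mat_spectrum A)"
    unfolding pairwise_def orthogonal_def by auto
  then have "finite (f ` mat_spectrum A)" by (rule pairwise_orthogonal_imp_finite)
  moreover have "inj_on f (mat_spectrum A)"
    using orth f(1) unfolding inj_on_def by (metis inner_eq_zero_iff)
  ultimately show ?thesis by (rule finite_imageD)
qed

lemma spectrum_le_op_norm:
  assumes "z \<in> mat_spectrum A"
  shows "cmod z \<le> op_norm A"
proof -
  obtain v where v: "v \<noteq> 0" "A *v v = z *s v" using assms unfolding mat_spectrum_def by blast
  have "norm (A *v v) \<le> op_norm A * norm v"
    unfolding op_norm_def by (rule onorm) simp
  then show ?thesis using v by (simp add: norm_smult)
qed

text \<open>The number \<open>m\<close> is squeezed: it bounds the norm of \<open>A\<close>, and as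
  an eigenvalue up to sign it cannot exceed the operator norm.\<close>

lemma op_norm_in_spectrum:
  fixes A :: "complex^'n^'n"
  assumes "self_adjoint A"
  shows "complex_of_real (op_norm A) \<in> mat_spectrum A \<or> - complex_of_real (op_norm A) \<in> mat_spectrum A"
proof -
  have ne: "\<exists>x\<in>UNIV. x \<noteq> (0 :: complex^'n)" by (auto intro: exI[of _ 1])
  obtain m v where m: "0 \<le> m" "\<And>x. norm (A *v x) \<le> m * norm x"
    and v: "v \<noteq> 0" "A *v v = m *\<^sub>R v \<or> A *v v = (- m) *\<^sub>R v"
    by (rule selfadjoint_norm_eigenvector[of "(*v) A" UNIV, OF _ _ _ _ ne])
      (use assms in \<open>auto simp: self_adjoint_def\<close>)
  have *: "complex_of_real m \<in> mat_spectrum A \<or> complex_of_real (- m) \<in> mat_spectrum A"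
    using v unfolding mat_spectrum_def of_real_smult[symmetric] by blast
  then have "m \<le> op_norm A" using m(1) spectrum_le_op_norm by fastforce
  moreover have "op_norm A \<le> m" unfolding op_norm_def using m by (intro onorm_bound) auto
  ultimately show ?thesis using * by simp
qed

lemma is_largest_op_norm:
  assumes "self_adjoint A" and "mat_spectrum A = uminus ` mat_spectrum A"
  shows "is_largest (mat_spectrum A) (op_norm A)"
  unfolding is_largest_def
proof (intro conjI ballI)
  show "mat_spectrum A \<subseteq> \<real>" by (rule self_adjoint_spectrum_real) fact
  show "complex_of_real (op_norm A) \<in> mat_spectrum A"
    using op_norm_in_spectrum[OF assms(1)] assms(2) by force
  show "Re z \<le> op_norm A" if "z \<in> mat_spectrum A" for z
    using spectrum_le_op_norm[OF that] complex_Re_le_cmod[of z] by linarith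
qed

lemma finite_is_smallest:
  assumes "finite S" "S \<noteq> {}" "S \<subseteq> \<real>"
  shows "\<exists>x. is_smallest S x"
proof -
  have "Min (Re ` S) \<in> Re ` S" using assms by (intro Min_in) auto
  then obtain z where z: "z \<in> S" "Re z = Min (Re ` S)" by auto
  then have "Re z \<le> Re w" if "w \<in> S" for w using that assms(1) by simp
  then have "is_smallest S (Re z)"
    using z(1) assms(3) unfolding is_smallest_def by (auto simp: of_real_Re subsetD)
  then show ?thesis ..
qed

section \<open>Characteristic determinants and inverses\<close>

lemma mat_vector_mult: "mat z *v v = z *s v" for v :: "'a::comm_ring_1^'n"
  by (simp add: matrix_vector_mult_def mat_def vec_eq_iff if_distrib if_distribR cong: if_cong)

lemma mat_spectrum_det: "mat_spectrum A = {z. det (mat z - A) = 0}"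
proof -
  have "(\<exists>v. v \<noteq> 0 \<and> A *v v = z *s v) \<longleftrightarrow> \<not> invertible (mat z - A)" for z
    unfolding invertible_left_inverse matrix_left_invertible_ker
    by (simp add: matrix_vector_mult_diff_rdistrib mat_vector_mult) metis
  then show ?thesis by (simp add: mat_spectrum_def invertible_det_nz)
qed

lemma matrix_inv_mult:
  assumes "invertible A"
  shows "A ** matrix_inv A = mat 1" "matrix_inv A ** A = mat 1"
proof -
  have "A ** matrix_inv A = mat 1 \<and> matrix_inv A ** A = mat 1"
    unfolding matrix_inv_def by (rule someI_ex) (use assms in \<open>simp add: invertible_def\<close>)
  then show "A ** matrix_inv A = mat 1" "matrix_inv A ** A = mat 1" by blast+
qed

lemma mat_spectrum_matrix_inv:
  fixes A :: "complex^'n^'n"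
  assumes "invertible A"
  shows "mat_spectrum (matrix_inv A) = inverse ` mat_spectrum A"
proof -
  \<comment> \<open>Stated for any one-sided inverse, so that exchanging the roles of the matrix and
    its inverse gives both inclusions.\<close>
  have sub: "inverse z \<in> mat_spectrum C" if z: "z \<in> mat_spectrum B" and CB: "C ** B = mat 1"
    for B C :: "complex^'n^'n" and z
  proof -
    obtain v where v: "v \<noteq> 0" "B *v v = z *s v" using z unfolding mat_spectrum_def by blast
    have "v = z *s (C *v v)"
      by (simp flip: matrix_vector_mult_smult v(2) add: matrix_vector_mul_assoc CB)
    moreover from this have "z \<noteq> 0" using v(1) by auto
    ultimately have "C *v v = inverse z *s v"
      by (metis left_inverse vector_smult_assoc vector_smult_lid)
    then show ?thesis using v(1) unfolding mat_spectrum_def by blast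
  qed
  show ?thesis
  proof (intro set_eqI iffI)
    fix z assume "z \<in> mat_spectrum (matrix_inv A)"
    then have "inverse z \<in> mat_spectrum A" using sub matrix_inv_mult(1)[OF assms] by simp
    then show "z \<in> inverse ` mat_spectrum A" by (metis image_eqI inverse_inverse_eq)
  next
    fix z assume "z \<in> inverse ` mat_spectrum A"
    then show "z \<in> mat_spectrum (matrix_inv A)"
      using sub[OF _ matrix_inv_mult(2)[OF assms]] by auto
  qed
qed

lemma self_adjoint_matrix_inv:
  assumes "self_adjoint A" "invertible A"
  shows "self_adjoint (matrix_inv A)"
  unfolding self_adjoint_def
proof (intro allI)
  fix x y
  let ?B = "matrix_inv A"
  have inv: "A *v (?B *v w) = w" for w
    by (simp add: matrix_vector_mul_assoc matrix_inv_mult assms)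
  have "(?B *v x) \<bullet> (A *v (?B *v y)) = (A *v (?B *v x)) \<bullet> (?B *v y)"
    using assms(1) by (simp add: self_adjoint_def)
  then show "(?B *v x) \<bullet> y = x \<bullet> (?B *v y)" by (simp add: inv)
qed

text \<open>For S the spectrum of \<Omega> and m the norm of its inverse, this identifies 1 / m with
  both descriptions of the minimal frequency: the least modulus and the least positive eigenvalue.
  They agree because S is real and symmetric.\<close>

lemma is_smallest_inverse_largest:
  assumes "S \<subseteq> \<real>" "0 \<notin> S" "S = uminus ` S" and m: "is_largest (inverse ` S) m"
  shows "is_smallest ((\<lambda>z. complex_of_real (cmod z)) ` S) (inverse m)"
    "is_smallest (S \<inter> complex_of_real ` {0<..}) (inverse m)"
proof -
  let ?x = "inverse m"
  have neg: "- z \<in> S" if "z \<in> S" for z using assms(3) that by blast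
  obtain z where z: "z \<in> S" "complex_of_real m = inverse z"
    using m unfolding is_largest_def by auto
  then have zx: "z = complex_of_real ?x" by (metis inverse_inverse_eq of_real_inverse)
  have "m \<noteq> 0" using z assms(2) by auto
  \<comment> \<open>By symmetry -m also lies in the set of inverses, so -m \<le> m; together with
    \<open>m \<noteq> 0\<close> this makes \<open>m\<close> positive.\<close>
  moreover have "Re (inverse (- z)) \<le> m"
    using m neg[OF z(1)] unfolding is_largest_def by blast
  ultimately have mpos: "0 < m" unfolding z(2) zx by simp
  have bound: "?x \<le> cmod w" if "w \<in> S" for w
  proof -
    have "w \<in> \<real>" using that assms(1) by blast
    then obtain a where a: "w = complex_of_real a" by (rule Reals_cases)
    have "complex_of_real \<bar>a\<bar> \<in> S" using that neg[OF that] a by (simp add: abs_if)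
    then have "Re (inverse (complex_of_real \<bar>a\<bar>)) \<le> m"
      using m unfolding is_largest_def by blast
    moreover have "a \<noteq> 0" using that assms(2) unfolding a by (metis of_real_0)
    ultimately have "inverse \<bar>a\<bar> \<le> m" by (simp flip: of_real_inverse)
    then have "inverse m \<le> \<bar>a\<bar>"
      using \<open>a \<noteq> 0\<close> le_imp_inverse_le[of "inverse \<bar>a\<bar>" m] by simp
    then show ?thesis by (simp add: a)
  qed
  have "cmod z = ?x" unfolding zx norm_of_real using mpos by simp
  then show "is_smallest ((\<lambda>z. complex_of_real (cmod z)) ` S) ?x"
    using z(1) bound unfolding is_smallest_def by (auto intro!: image_eqI[of _ _ z])
  have "?x \<le> Re w" if "w \<in> S" "w \<in> complex_of_real ` {0<..}" for w
    using bound[OF that(1)] that(2) by auto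
  moreover have "complex_of_real ?x \<in> complex_of_real ` {0<..}"
    using mpos by (intro imageI) simp
  ultimately show "is_smallest (S \<inter> complex_of_real ` {0<..}) ?x"
    using z(1) assms(1) unfolding is_smallest_def zx by blast
qed

section \<open>The quadratic pencil and its linearization\<close>

lemma cmat_mult: "cmat (A ** B) = cmat A ** cmat B"
  by (simp add: matrix_matrix_mult_def vec_eq_iff)

lemma cmat_mat: "cmat (mat c) = mat (complex_of_real c)"
  by (simp add: mat_def vec_eq_iff)

lemma det_cmat: "det (cmat A) = complex_of_real (det A)"
  by (simp add: det_def)

lemma scale_mat_mult: "(c *\<^sub>m A) ** B = c *\<^sub>m (A ** B)" "A ** (c *\<^sub>m B) = c *\<^sub>m (A ** B)"
  by (simp_all add: scale_mat_def matrix_matrix_mult_def vec_eq_iff sum_distrib_left mult_ac)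

lemma matrix_mult_add_diff:
  fixes A B :: "'a::comm_ring_1^'n^'m"
  shows "(A + B) ** C = A ** C + B ** C" "(A - B) ** C = A ** C - B ** C"
    "D ** (A - B) = D ** A - D ** B"
  by (simp_all add: matrix_matrix_mult_def vec_eq_iff sum.distrib sum_subtractf algebra_simps)

lemma det_scale_mat: "det (c *\<^sub>m A) = c ^ CARD('n) * det A" for A :: "complex^'n^'n"
  by (simp flip: mat_mult_eq_scale(1) add: det_mul det_mat)

lemma pos_def_imp_pos_semidef: "pos_def A \<Longrightarrow> pos_semidef A"
  unfolding pos_def_def pos_semidef_def by (metis inner_zero_left order_le_less)

lemma pos_def_det_nonzero:
  assumes "pos_def A"
  shows "det A \<noteq> 0"
proof -
  have "\<forall>x. A *v x = 0 \<longrightarrow> x = 0"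
    using assms unfolding pos_def_def by (metis inner_zero_right less_irrefl)
  then show ?thesis
    by (simp add: invertible_det_nz[symmetric] invertible_left_inverse matrix_left_invertible_ker)
qed

text \<open>Congruence by \<open>P\<close> turns \<open>A\<close> into the identity, and the last
  identity gives the determinant factor that this congruence costs.\<close>

lemma inv_psd_sqrt:
  fixes A :: "real^'n^'n"
  assumes "pos_def A"
  defines "P \<equiv> matrix_inv (psd_sqrt A)"
  shows "transpose P = P" "P ** A ** P = mat 1" "P ** psd_sqrt A = mat 1" "psd_sqrt A ** P = mat 1"
    "det P * det P = inverse (det A)"
proof -
  let ?S = "psd_sqrt A"
  have S: "transpose ?S = ?S" "?S ** ?S = A"
    using psd_sqrt[OF pos_def_imp_pos_semidef[OF assms(1)]] by (auto simp: pos_semidef_def)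
  have dS: "det ?S * det ?S = det A" by (metis S(2) det_mul)
  then have "invertible ?S" using pos_def_det_nonzero[OF assms(1)] by (auto simp: invertible_det_nz)
  then show PS: "P ** ?S = mat 1" "?S ** P = mat 1" unfolding P_def by (auto simp: matrix_inv_mult)
  have "transpose P = transpose P ** (?S ** P)" by (simp add: PS)
  also have "\<dots> = transpose (?S ** P) ** P" by (simp add: matrix_transpose_mul S matrix_mul_assoc)
  finally show "transpose P = P" by (simp add: PS transpose_mat)
  have "P ** (?S ** ?S) ** P = (P ** ?S) ** (?S ** P)" by (simp only: matrix_mul_assoc)
  then show "P ** A ** P = mat 1" by (simp add: PS S(2))
  have "det P * det ?S = 1" by (metis PS(1) det_mul det_I)
  then have "(det P * det P) * det A = 1" by (simp flip: dS add: algebra_simps)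
  then show "det P * det P = inverse (det A)" by (metis inverse_unique mult.commute)
qed

lemma pencil_zero_beta:
  "pencil \<alpha> \<eta> \<theta> R z 0 = z\<^sup>2 *\<^sub>m cmat \<alpha> + (2 * \<i> * z) *\<^sub>m cmat \<theta> - cmat \<eta>"
  by (simp add: pencil_def scale_mat_def vec_eq_iff)

lemma det_Omega:
  fixes \<alpha> \<eta> \<theta> :: "real^'n^'n"
  assumes "pos_def \<alpha>" "pos_semidef \<eta>"
  shows "det (mat z - Omega_mat \<alpha> \<eta> \<theta>)
    = inverse (complex_of_real (det \<alpha>)) * det (z\<^sup>2 *\<^sub>m cmat \<alpha> + (2 * \<i> * z) *\<^sub>m cmat \<theta> - cmat \<eta>)"
proof -
  define P where "P = matrix_inv (psd_sqrt \<alpha>)"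
  note P = inv_psd_sqrt[OF assms(1), folded P_def]
  let ?F = "Phi_mat \<alpha> \<eta>"
  have "transpose ?F ** ?F = P ** (psd_sqrt \<eta> ** psd_sqrt \<eta>) ** P"
    using psd_sqrt(1)[OF assms(2)]
    by (simp add: Phi_mat_def P_def[symmetric] matrix_transpose_mul P matrix_mul_assoc pos_semidef_def)
  then have F: "cmat (transpose ?F) ** cmat ?F = cmat P ** cmat \<eta> ** cmat P"
    by (simp add: psd_sqrt(2)[OF assms(2)] flip: cmat_mult)
  \<comment> \<open>Written this way, the term \<open>z\<^sup>2 *\<^sub>m mat 1\<close> becomes a
    congruence by \<open>P\<close>, like the terms in \<theta> and \<eta>, and \<open>P\<close>
    factors out on both sides.\<close>
  have one: "mat 1 = cmat P ** cmat \<alpha> ** cmat P"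
    using P(2) by (simp flip: cmat_mult add: cmat_mat)
  have "mat z - Omega_mat \<alpha> \<eta> \<theta> = block_mat (mat z - (- 2 * \<i>) *\<^sub>m cmat (P ** \<theta> ** P))
      (- ((- \<i>) *\<^sub>m cmat (transpose ?F))) (- (\<i> *\<^sub>m cmat ?F)) (mat z)"
    unfolding Omega_mat_def P_def[symmetric] by (subst mat_eq_block_mat) (simp add: block_mat_diff)
  then have "det (mat z - Omega_mat \<alpha> \<eta> \<theta>)
      = det (z *\<^sub>m (mat z - (- 2 * \<i>) *\<^sub>m cmat (P ** \<theta> ** P))
          - (- ((- \<i>) *\<^sub>m cmat (transpose ?F))) ** (- (\<i> *\<^sub>m cmat ?F)))"
    by (simp add: det_block_mat_scalar)
  also have "(- ((- \<i>) *\<^sub>m cmat (transpose ?F))) ** (- (\<i> *\<^sub>m cmat ?F)) = cmat P ** cmat \<eta> ** cmat P"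
    by (simp add: matrix_neg_mult scale_mat_mult F) (simp add: scale_mat_def vec_eq_iff)
  also have "z *\<^sub>m (mat z - (- 2 * \<i>) *\<^sub>m cmat (P ** \<theta> ** P))
      = z\<^sup>2 *\<^sub>m mat 1 + (2 * \<i> * z) *\<^sub>m (cmat P ** cmat \<theta> ** cmat P)"
    by (simp add: scale_mat_def vec_eq_iff cmat_mult mat_def power2_eq_square algebra_simps)
  also have "\<dots> - cmat P ** cmat \<eta> ** cmat P
      = cmat P ** (z\<^sup>2 *\<^sub>m cmat \<alpha> + (2 * \<i> * z) *\<^sub>m cmat \<theta> - cmat \<eta>) ** cmat P"
    by (simp add: one matrix_mult_add_diff matrix_add_ldistrib scale_mat_mult)
  finally show ?thesis
    using P(5) by (simp add: det_mul det_cmat mult_ac flip: of_real_inverse of_real_mult)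
qed

lemma det_B:
  fixes \<alpha> R :: "real^'n^'n"
  assumes "pos_def \<alpha>"
  shows "det (mat z - B_mat \<alpha> R)
    = z ^ CARD('n) * inverse (complex_of_real (det \<alpha>)) * det (z *\<^sub>m cmat \<alpha> - cmat R)"
proof -
  define P where "P = matrix_inv (psd_sqrt \<alpha>)"
  note P = inv_psd_sqrt[OF assms(1), folded P_def]
  have one: "mat 1 = cmat P ** cmat \<alpha> ** cmat P"
    using P(2) by (simp flip: cmat_mult add: cmat_mat)
  have "mat z - B_mat \<alpha> R = block_mat (mat z - cmat (P ** R ** P)) 0 0 (mat z)"
    unfolding B_mat_def P_def[symmetric] by (subst mat_eq_block_mat) (simp add: block_mat_diff)
  then have "det (mat z - B_mat \<alpha> R) = z ^ CARD('n) * det (mat z - cmat (P ** R ** P))"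
    by (simp add: det_block_mat_upper det_mat)
  also have "mat z - cmat (P ** R ** P) = z *\<^sub>m mat 1 - cmat P ** cmat R ** cmat P"
    by (simp add: scale_mat_def vec_eq_iff cmat_mult mat_def)
  also have "\<dots> = cmat P ** (z *\<^sub>m cmat \<alpha> - cmat R) ** cmat P"
    by (simp add: one matrix_mult_add_diff scale_mat_mult)
  finally show ?thesis
    using P(5) by (simp add: det_mul det_cmat mult_ac flip: of_real_inverse of_real_mult)
qed

section \<open>Reality, symmetry and duality of the spectrum of \<open>Omega_mat\<close>\<close>

lemma spectrum_Omega:
  fixes \<alpha> \<eta> \<theta> :: "real^'n^'n"
  assumes "pos_def \<alpha>" "pos_semidef \<eta>"
  shows "mat_spectrum (Omega_mat \<alpha> \<eta> \<theta>)
    = {z. det (z\<^sup>2 *\<^sub>m cmat \<alpha> + (2 * \<i> * z) *\<^sub>m cmat \<theta> - cmat \<eta>) = 0}"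
  using pos_def_det_nonzero[OF assms(1)] by (simp add: mat_spectrum_det det_Omega[OF assms])

lemma transpose_eq_nth: "transpose A = B \<Longrightarrow> A $ j $ i = B $ i $ j"
  by (auto simp: transpose_def)

text \<open>The congruence by the symmetric \<open>P\<close> keeps \<theta> antisymmetric, and an
  imaginary multiple of a real antisymmetric matrix is Hermitian. The off-diagonal blocks are
  conjugate transposes of each other by construction.\<close>

lemma self_adjoint_Omega:
  assumes "pos_def \<alpha>" "transpose \<theta> = - \<theta>"
  shows "self_adjoint (Omega_mat \<alpha> \<eta> \<theta>)"
proof (rule self_adjointI)
  define P where "P = matrix_inv (psd_sqrt \<alpha>)"
  note P = inv_psd_sqrt[OF assms(1), folded P_def]
  have tr: "transpose (P ** \<theta> ** P) = - (P ** \<theta> ** P)"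
    by (simp add: matrix_transpose_mul P assms(2) matrix_neg_mult matrix_mul_assoc)
  have skew: "(P ** \<theta> ** P) $ j $ i = - ((P ** \<theta> ** P) $ i $ j)" for i j
    using transpose_eq_nth[OF tr, of j i] by simp
  show "Omega_mat \<alpha> \<eta> \<theta> $ i $ j = cnj (Omega_mat \<alpha> \<eta> \<theta> $ j $ i)" for i j
  proof (cases "\<exists>a b. i = Inl a \<and> j = Inl b")
    case True
    then obtain a b where "i = Inl a" "j = Inl b" by blast
    then show ?thesis
      using skew[of a b] by (simp add: Omega_mat_def P_def[symmetric] scale_mat_def)
  next
    case False
    then show ?thesis
      by (cases i; cases j) (simp_all add: Omega_mat_def scale_mat_def transpose_def)
  qed
qed

lemma spectrum_Omega_symmetric:
  fixes \<alpha> \<eta> \<theta> :: "real^'n^'n"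
  assumes "pos_def \<alpha>" "pos_semidef \<eta>" "transpose \<theta> = - \<theta>"
  shows "mat_spectrum (Omega_mat \<alpha> \<eta> \<theta>) = uminus ` mat_spectrum (Omega_mat \<alpha> \<eta> \<theta>)"
proof -
  let ?C = "\<lambda>z. z\<^sup>2 *\<^sub>m cmat \<alpha> + (2 * \<i> * z) *\<^sub>m cmat \<theta> - cmat \<eta>"
  have tr: "transpose \<alpha> = \<alpha>" "transpose \<eta> = \<eta>"
    using assms by (simp_all add: pos_def_def pos_semidef_def)
  have "?C (- z) $ i $ j = transpose (?C z) $ i $ j" for z i j
    using transpose_eq_nth[OF tr(1), of j i] transpose_eq_nth[OF tr(2), of j i]
      transpose_eq_nth[OF assms(3), of j i]
    by (simp add: transpose_def scale_mat_def)
  then have "?C (- z) = transpose (?C z)" for z by (simp only: vec_eq_iff) blast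
  then have "det (?C (- z)) = det (?C z)" for z by simp
  then have "- z \<in> mat_spectrum (Omega_mat \<alpha> \<eta> \<theta>)" if "z \<in> mat_spectrum (Omega_mat \<alpha> \<eta> \<theta>)" for z
    using that by (simp add: spectrum_Omega[OF assms(1,2)])
  then show ?thesis by force
qed

lemma zero_notin_spectrum_Omega:
  fixes \<alpha> \<eta> \<theta> :: "real^'n^'n"
  assumes "pos_def \<alpha>" "pos_def \<eta>"
  shows "0 \<notin> mat_spectrum (Omega_mat \<alpha> \<eta> \<theta>)"
proof -
  have "- cmat \<eta> = (- 1) *\<^sub>m cmat \<eta>" by (simp add: vec_eq_iff scale_mat_def)
  then have "det (- cmat \<eta>) \<noteq> 0"
    using pos_def_det_nonzero[OF assms(2)] by (simp add: det_scale_mat det_cmat)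
  then show ?thesis
    using assms by (simp add: spectrum_Omega pos_def_imp_pos_semidef scale_mat_zero)
qed

lemma spectrum_Omega_dual:
  fixes \<alpha> \<eta> \<theta> :: "real^'n^'n"
  assumes "pos_def \<alpha>" "pos_def \<eta>"
  shows "mat_spectrum (Omega_mat \<eta> \<alpha> \<theta>) = (\<lambda>z. - inverse z) ` mat_spectrum (Omega_mat \<alpha> \<eta> \<theta>)"
proof -
  \<comment> \<open>Quantified over the pair of matrices: as z -> -1 / z is an involution, the same
    inclusion with the pair exchanged is the converse.\<close>
  have sub: "- inverse z \<in> mat_spectrum (Omega_mat \<eta> \<alpha> \<theta>)"
    if "pos_def \<alpha>" "pos_def \<eta>" and z: "z \<in> mat_spectrum (Omega_mat \<alpha> \<eta> \<theta>)"
    for z and \<alpha> \<eta> :: "real^'n^'n"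
  proof -
    have "z \<noteq> 0" using z zero_notin_spectrum_Omega[OF that(1,2)] by blast
    let ?w = "- inverse z"
    have "?w\<^sup>2 *\<^sub>m cmat \<eta> + (2 * \<i> * ?w) *\<^sub>m cmat \<theta> - cmat \<alpha>
        = (- inverse (z\<^sup>2)) *\<^sub>m (z\<^sup>2 *\<^sub>m cmat \<alpha> + (2 * \<i> * z) *\<^sub>m cmat \<theta> - cmat \<eta>)"
      using \<open>z \<noteq> 0\<close> by (simp add: vec_eq_iff scale_mat_def field_simps power2_eq_square)
    then show ?thesis
      using that by (simp add: spectrum_Omega pos_def_imp_pos_semidef det_scale_mat)
  qed
  show ?thesis
  proof (intro set_eqI iffI)
    fix z assume "z \<in> mat_spectrum (Omega_mat \<eta> \<alpha> \<theta>)"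
    then have "- inverse z \<in> mat_spectrum (Omega_mat \<alpha> \<eta> \<theta>)" using sub assms by blast
    then show "z \<in> (\<lambda>z. - inverse z) ` mat_spectrum (Omega_mat \<alpha> \<eta> \<theta>)"
      by (intro image_eqI[of _ _ "- inverse z"]) simp_all
  next
    fix z assume "z \<in> (\<lambda>z. - inverse z) ` mat_spectrum (Omega_mat \<alpha> \<eta> \<theta>)"
    then show "z \<in> mat_spectrum (Omega_mat \<eta> \<alpha> \<theta>)" using sub assms by blast
  qed
qed

section \<open>Nonzero eigenvalues of \<open>B_mat\<close>\<close>

text \<open>Multiplying z - \<alpha>^-1 R by \<alpha> gives z \<alpha> - R, the matrix in
  \<open>det_B\<close>. The power of z there vanishes only at zero, which is removed.\<close>

lemma spectrum_B:
  fixes \<alpha> R :: "real^'n^'n"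
  assumes "pos_def \<alpha>"
  shows "mat_spectrum (B_mat \<alpha> R) - {0} = mat_spectrum (cmat (matrix_inv \<alpha> ** R)) - {0}"
proof -
  have a: "\<alpha> ** matrix_inv \<alpha> = mat 1"
    using pos_def_det_nonzero[OF assms] by (simp add: matrix_inv_mult invertible_det_nz)
  have "cmat \<alpha> ** (mat z - cmat (matrix_inv \<alpha> ** R)) = z *\<^sub>m cmat \<alpha> - cmat R" for z
    by (simp add: matrix_mult_add_diff matrix_mul_assoc a mat_mult_eq_scale flip: cmat_mult)
  then have "complex_of_real (det \<alpha>) * det (mat z - cmat (matrix_inv \<alpha> ** R))
      = det (z *\<^sub>m cmat \<alpha> - cmat R)" for z
    by (metis det_mul det_cmat)
  from this[symmetric] show ?thesis
    using pos_def_det_nonzero[OF assms] by (auto simp: mat_spectrum_det det_B[OF assms])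
qed

lemma self_adjoint_B:
  assumes "pos_def \<alpha>" "transpose R = R"
  shows "self_adjoint (B_mat \<alpha> R)"
proof (rule self_adjointI)
  define P where "P = matrix_inv (psd_sqrt \<alpha>)"
  note P = inv_psd_sqrt[OF assms(1), folded P_def]
  have "transpose (P ** R ** P) = P ** R ** P"
    by (simp add: matrix_transpose_mul P assms(2) matrix_mul_assoc)
  note sym = transpose_eq_nth[OF this]
  show "B_mat \<alpha> R $ i $ j = cnj (B_mat \<alpha> R $ j $ i)" for i j
    unfolding B_mat_def P_def[symmetric] by (cases i; cases j) (use sym in auto)
qed

text \<open>Reality and finiteness are read off \<open>B_mat\<close>, since the product \<alpha>^-1
  R is in general not symmetric. If zero were the only eigenvalue, the norm of the self-adjoint
  \<open>B_mat\<close> would be zero, hence P R P = 0, and undoing the congruence would give R =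
  0.\<close>

lemma spectrum_B_smallest:
  fixes \<alpha> R :: "real^'n^'n"
  assumes "pos_def \<alpha>" "transpose R = R" "R \<noteq> 0"
  shows "\<exists>b. is_smallest (mat_spectrum (B_mat \<alpha> R) - {0}) b"
proof (rule finite_is_smallest)
  note B = self_adjoint_B[OF assms(1,2)]
  show "finite (mat_spectrum (B_mat \<alpha> R) - {0})" using self_adjoint_spectrum_finite[OF B] by simp
  show "mat_spectrum (B_mat \<alpha> R) - {0} \<subseteq> \<real>" using self_adjoint_spectrum_real[OF B] by blast
  show "mat_spectrum (B_mat \<alpha> R) - {0} \<noteq> {}"
  proof
    assume "mat_spectrum (B_mat \<alpha> R) - {0} = {}"
    then have "op_norm (B_mat \<alpha> R) = 0" using op_norm_in_spectrum[OF B] by auto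
    then have "B_mat \<alpha> R *v x = 0 *v x" for x
      by (simp add: op_norm_def onorm_eq_0)
    then have "B_mat \<alpha> R = 0" by (simp add: matrix_eq)
    define P where "P = matrix_inv (psd_sqrt \<alpha>)"
    note P = inv_psd_sqrt[OF assms(1), folded P_def]
    have "complex_of_real ((P ** R ** P) $ i $ j) = B_mat \<alpha> R $ Inl i $ Inl j" for i j
      by (simp add: B_mat_def P_def)
    then have "P ** R ** P = 0" using \<open>B_mat \<alpha> R = 0\<close> by (simp add: vec_eq_iff)
    moreover have "psd_sqrt \<alpha> ** (P ** R ** P) ** psd_sqrt \<alpha>
        = (psd_sqrt \<alpha> ** P) ** R ** (P ** psd_sqrt \<alpha>)"
      by (simp add: matrix_mul_assoc)
    ultimately show False using assms(3) by (simp add: P)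
  qed
qed

theorem proposition21:
  fixes \<alpha> \<eta> \<theta> R :: "real^'n^'n"
  assumes "pos_def \<alpha>" and "pos_semidef \<eta>" and "transpose \<theta> = - \<theta>" and "pos_semidef R"
    and "rank R > 0"
  shows "(\<forall>\<zeta>. det (mat \<zeta> - Omega_mat \<alpha> \<eta> \<theta>)
              = inverse (complex_of_real (det \<alpha>)) * det (pencil \<alpha> \<eta> \<theta> R \<zeta> 0)
            \<and> inverse (complex_of_real (det \<alpha>)) * det (pencil \<alpha> \<eta> \<theta> R \<zeta> 0)
              = inverse (complex_of_real (det \<alpha>))
                * det (\<zeta>\<^sup>2 *\<^sub>m cmat \<alpha> + (2 * \<i> * \<zeta>) *\<^sub>m cmat \<theta> - cmat \<eta>)
            \<and> det (mat \<zeta> - B_mat \<alpha> R)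
              = \<zeta> ^ CARD('n) * inverse (complex_of_real (det \<alpha>)) * det (\<zeta> *\<^sub>m cmat \<alpha> - cmat R))
    \<and> mat_spectrum (Omega_mat \<alpha> \<eta> \<theta>) = pencil_spectrum (\<lambda>\<zeta>. pencil \<alpha> \<eta> \<theta> R \<zeta> 0)
    \<and> pencil_spectrum (\<lambda>\<zeta>. pencil \<alpha> \<eta> \<theta> R \<zeta> 0) \<subseteq> \<real>
    \<and> mat_spectrum (Omega_mat \<alpha> \<eta> \<theta>) = uminus ` mat_spectrum (Omega_mat \<alpha> \<eta> \<theta>)
    \<and> mat_spectrum (B_mat \<alpha> R) - {0} = mat_spectrum (cmat (matrix_inv \<alpha> ** R)) - {0}
    \<and> (\<exists>b_min. is_smallest (mat_spectrum (B_mat \<alpha> R) - {0}) b_min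
           \<and> is_smallest (mat_spectrum (cmat (matrix_inv \<alpha> ** R)) - {0}) b_min)
    \<and> (\<exists>\<omega>_max. is_largest (mat_spectrum (Omega_mat \<alpha> \<eta> \<theta>)) \<omega>_max
           \<and> \<omega>_max = op_norm (Omega_mat \<alpha> \<eta> \<theta>)
           \<and> is_largest (pencil_spectrum (\<lambda>\<zeta>. pencil \<alpha> \<eta> \<theta> R \<zeta> 0)) \<omega>_max)
    \<and> (pos_def \<eta> \<longrightarrow>
         invertible (Omega_mat \<alpha> \<eta> \<theta>)
       \<and> mat_spectrum (Omega_flat \<alpha> \<eta> \<theta>) = (\<lambda>\<zeta>. - inverse \<zeta>) ` mat_spectrum (Omega_mat \<alpha> \<eta> \<theta>)
       \<and> (\<lambda>\<zeta>. - inverse \<zeta>) ` mat_spectrum (Omega_mat \<alpha> \<eta> \<theta>)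
           = mat_spectrum (matrix_inv (Omega_mat \<alpha> \<eta> \<theta>))
       \<and> mat_spectrum (B_flat \<eta> R) - {0} = mat_spectrum (cmat (matrix_inv \<eta> ** R)) - {0}
       \<and> (\<exists>b_min. is_smallest (mat_spectrum (B_flat \<eta> R) - {0}) b_min
              \<and> is_smallest (mat_spectrum (cmat (matrix_inv \<eta> ** R)) - {0}) b_min)
       \<and> (\<exists>\<omega>_max \<omega>_min.
              is_largest (mat_spectrum (Omega_flat \<alpha> \<eta> \<theta>)) \<omega>_max
            \<and> is_smallest ((\<lambda>\<zeta>. complex_of_real (cmod \<zeta>)) ` mat_spectrum (Omega_mat \<alpha> \<eta> \<theta>)) \<omega>_min
            \<and> is_smallest (mat_spectrum (Omega_mat \<alpha> \<eta> \<theta>) \<inter> complex_of_real ` {0<..}) \<omega>_min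
            \<and> \<omega>_max = op_norm (Omega_flat \<alpha> \<eta> \<theta>)
            \<and> op_norm (Omega_flat \<alpha> \<eta> \<theta>) = op_norm (matrix_inv (Omega_mat \<alpha> \<eta> \<theta>))
            \<and> op_norm (matrix_inv (Omega_mat \<alpha> \<eta> \<theta>)) = inverse \<omega>_min))"
proof -
  note psd = pos_def_imp_pos_semidef
  let ?O = "Omega_mat \<alpha> \<eta> \<theta>" and ?S = "mat_spectrum (Omega_mat \<alpha> \<eta> \<theta>)"
  have specO: "?S = pencil_spectrum (\<lambda>\<zeta>. pencil \<alpha> \<eta> \<theta> R \<zeta> 0)"
    using assms by (simp add: spectrum_Omega pencil_spectrum_def pencil_zero_beta)
  have saO: "self_adjoint ?O" using assms by (simp add: self_adjoint_Omega)
  have real: "?S \<subseteq> \<real>" by (rule self_adjoint_spectrum_real[OF saO])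
  have sym: "?S = uminus ` ?S" using assms by (intro spectrum_Omega_symmetric)
  \<comment> \<open>Positive rank enters as \<open>R \<noteq> 0\<close>, which provides a nonzero
    eigenvalue of \<open>B_mat\<close>.\<close>
  have R: "transpose R = R" "R \<noteq> 0"
    using assms(4,5) by (auto simp: pos_semidef_def)
  have bmin: "\<exists>b. is_smallest (mat_spectrum (B_mat \<gamma> R) - {0}) b
      \<and> is_smallest (mat_spectrum (cmat (matrix_inv \<gamma> ** R)) - {0}) b" if "pos_def \<gamma>" for \<gamma>
    using spectrum_B_smallest[OF that R] by (simp add: spectrum_B[OF that])
  have dual: "pos_def \<eta> \<longrightarrow> invertible ?O
       \<and> mat_spectrum (Omega_flat \<alpha> \<eta> \<theta>) = (\<lambda>\<zeta>. - inverse \<zeta>) ` ?S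
       \<and> (\<lambda>\<zeta>. - inverse \<zeta>) ` ?S = mat_spectrum (matrix_inv ?O)
       \<and> mat_spectrum (B_flat \<eta> R) - {0} = mat_spectrum (cmat (matrix_inv \<eta> ** R)) - {0}
       \<and> (\<exists>b_min. is_smallest (mat_spectrum (B_flat \<eta> R) - {0}) b_min
              \<and> is_smallest (mat_spectrum (cmat (matrix_inv \<eta> ** R)) - {0}) b_min)
       \<and> (\<exists>\<omega>_max \<omega>_min.
              is_largest (mat_spectrum (Omega_flat \<alpha> \<eta> \<theta>)) \<omega>_max
            \<and> is_smallest ((\<lambda>\<zeta>. complex_of_real (cmod \<zeta>)) ` ?S) \<omega>_min
            \<and> is_smallest (?S \<inter> complex_of_real ` {0<..}) \<omega>_min
            \<and> \<omega>_max = op_norm (Omega_flat \<alpha> \<eta> \<theta>)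
            \<and> op_norm (Omega_flat \<alpha> \<eta> \<theta>) = op_norm (matrix_inv ?O)
            \<and> op_norm (matrix_inv ?O) = inverse \<omega>_min)" (is "_ \<longrightarrow> ?dual")
  proof
    assume \<eta>: "pos_def \<eta>"
    have flat: "mat_spectrum (Omega_flat \<alpha> \<eta> \<theta>) = (\<lambda>\<zeta>. - inverse \<zeta>) ` ?S"
      unfolding Omega_flat_def using assms(1) \<eta> by (rule spectrum_Omega_dual)
    have zero: "0 \<notin> ?S" using assms(1) \<eta> by (rule zero_notin_spectrum_Omega)
    then have inv: "invertible ?O"
      unfolding mat_spectrum_def invertible_left_inverse matrix_left_invertible_ker by force
    \<comment> \<open>The symmetry of the spectrum absorbs the sign, so the negative inverses are
      exactly the inverses.\<close>
    have "(\<lambda>\<zeta>. - inverse \<zeta>) ` ?S = inverse ` (uminus ` ?S)" by (simp add: image_image)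
    then have inverse: "(\<lambda>\<zeta>. - inverse \<zeta>) ` ?S = inverse ` ?S" using sym by simp
    have spec_inv: "(\<lambda>\<zeta>. - inverse \<zeta>) ` ?S = mat_spectrum (matrix_inv ?O)"
      by (simp add: inverse mat_spectrum_matrix_inv[OF inv])
    have saF: "self_adjoint (Omega_flat \<alpha> \<eta> \<theta>)"
      unfolding Omega_flat_def using \<eta> assms(3) by (rule self_adjoint_Omega)
    have symF: "mat_spectrum (Omega_flat \<alpha> \<eta> \<theta>) = uminus ` mat_spectrum (Omega_flat \<alpha> \<eta> \<theta>)"
      unfolding Omega_flat_def using \<eta> psd[OF assms(1)] assms(3) by (rule spectrum_Omega_symmetric)
    have F: "is_largest (mat_spectrum (Omega_flat \<alpha> \<eta> \<theta>)) (op_norm (Omega_flat \<alpha> \<eta> \<theta>))"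
      using saF symF by (rule is_largest_op_norm)
    \<comment> \<open>The spectrum of the inverse is the same set as that of
      \<open>Omega_flat\<close>, so its symmetry is already known.\<close>
    have I: "is_largest (mat_spectrum (matrix_inv ?O)) (op_norm (matrix_inv ?O))"
      using self_adjoint_matrix_inv[OF saO inv] symF
      by (intro is_largest_op_norm) (simp_all add: flat spec_inv)
    \<comment> \<open>The two matrices need not be compared: both norms are the largest element of
      the same set.\<close>
    have eq: "op_norm (Omega_flat \<alpha> \<eta> \<theta>) = op_norm (matrix_inv ?O)"
      using F I unfolding flat spec_inv is_largest_def by (metis Re_complex_of_real order_antisym)
    have "is_largest (inverse ` ?S) (op_norm (matrix_inv ?O))"
      using I by (simp add: mat_spectrum_matrix_inv[OF inv])
    note small = is_smallest_inverse_largest[OF real zero sym this]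
    have "\<exists>\<omega>_max \<omega>_min.
              is_largest (mat_spectrum (Omega_flat \<alpha> \<eta> \<theta>)) \<omega>_max
            \<and> is_smallest ((\<lambda>\<zeta>. complex_of_real (cmod \<zeta>)) ` ?S) \<omega>_min
            \<and> is_smallest (?S \<inter> complex_of_real ` {0<..}) \<omega>_min
            \<and> \<omega>_max = op_norm (Omega_flat \<alpha> \<eta> \<theta>)
            \<and> op_norm (Omega_flat \<alpha> \<eta> \<theta>) = op_norm (matrix_inv ?O)
            \<and> op_norm (matrix_inv ?O) = inverse \<omega>_min"
      using F small eq by (metis inverse_inverse_eq)
    then show "?dual"
      unfolding B_flat_def by (intro conjI inv flat spec_inv spectrum_B[OF \<eta>] bmin[OF \<eta>])
  qed
  have largest: "is_largest ?S (op_norm ?O)" using saO sym by (rule is_largest_op_norm)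
  have det: "\<forall>\<zeta>. det (mat \<zeta> - ?O)
              = inverse (complex_of_real (det \<alpha>)) * det (pencil \<alpha> \<eta> \<theta> R \<zeta> 0)
            \<and> inverse (complex_of_real (det \<alpha>)) * det (pencil \<alpha> \<eta> \<theta> R \<zeta> 0)
              = inverse (complex_of_real (det \<alpha>))
                * det (\<zeta>\<^sup>2 *\<^sub>m cmat \<alpha> + (2 * \<i> * \<zeta>) *\<^sub>m cmat \<theta> - cmat \<eta>)
            \<and> det (mat \<zeta> - B_mat \<alpha> R)
              = \<zeta> ^ CARD('n) * inverse (complex_of_real (det \<alpha>)) * det (\<zeta> *\<^sub>m cmat \<alpha> - cmat R)"
    by (simp add: det_Omega[OF assms(1,2)] det_B[OF assms(1)] pencil_zero_beta)
  \<comment> \<open>The repeated conjunct stands for the pencil spectrum, which is rewritten to the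
    spectrum of \<open>Omega_mat\<close> in the final goal.\<close>
  have max: "\<exists>\<omega>_max. is_largest ?S \<omega>_max \<and> \<omega>_max = op_norm ?O \<and> is_largest ?S \<omega>_max"
    using largest by blast
  show ?thesis
    unfolding specO[symmetric]
    by (intro conjI refl det real sym spectrum_B[OF assms(1)] bmin[OF assms(1)] max dual)
qed

end
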